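(* Fix a clock $C$ with normalization data $(\iota,\mathfrak a)$. Let $h:(X,p)\to(Y,q)$ be a morphism in $\mathbf{Timed}(C)$. Then for every directed path $x$ of $X$ and every $s\in\mathbb I$, $$h\circ N_p(x)=N_q(h\circ x),\qquad h\circ H_p(x,s)=H_q(h\circ x,s).$$ The canonical homotopy lifts are also natural for these morphisms: for all $u,v\in|X|$, every $Z\in\mathbf{Top}$ and all continuous maps $a:Z\to\overrightarrow{\mathcal P}(X)(u,v)$ and $B:Z\times\mathbb I\to\overrightarrow{\mathcal T}(X)(u,v)$ such that $B(z,0)$ is the trace of $a(z)$ for all $z$, the image under $h_*:\overrightarrow{\mathcal P}(X)(u,v)\to\overrightarrow{\mathcal P}(Y)(h(u),h(v))$ of the canonical lift of $(a,B)$ is the canonical lift of $(h_*a,h_*B)$.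
   Context: $\mathbb I=[0,1]$. $\mathbf{Top}$ denotes either the category of $\Delta$-generated spaces (topology final with respect to continuous maps from standard simplices), or its full subcategory of $\Delta$-Hausdorff spaces (images of continuous maps from $\mathbb I$ are closed); the statement is asserted for each choice. $k_\Delta Y$ is the set $Y$ with the final topology with respect to continuous maps from standard simplices to $Y$. A directed space $X=(|X|,dX)$ is a space $|X|\in\mathbf{Top}$ with a set $dX$ of continuous maps $\mathbb I\to|X|$ (directed paths) containing constant paths and closed under precomposition with continuous nondecreasing maps $\mathbb I\to\mathbb I$ and under normalized concatenation. Directed maps are continuous maps preserving directed paths. $\mathsf{Rep}_+$ is the monoid of continuous nondecreasing surjections $\mathbb I\to\mathbb I$. $X$ is saturated if $x\circ\phi\in dX$ with $x$ continuous, $\phi\in\mathsf{Rep}_+$ implies $x\in dX$. A directed map $p$ is regular if $p\circ x$ constant implies $x$ constant for every directed path $x$. A clock is a directed space $C$ such that $|C|$ admits a continuous injective map into a metric space. A timed space over $C$ is a regular directed map $p:X\to C$ with $X$ saturated, also written $(X,p)$; a morphism $(X,p)\to(Y,q)$ in $\mathbf{Timed}(C)$ is a directed map $h:X\to Y$ with $qh=p$. $\overrightarrow{\mathcal P}(X)(u,v)=k_\Delta\{x\in dX\mid x(0)=u,x(1)=v\}$ (relative compact-open topology inside); $\overrightarrow{\mathcal T}(X)(u,v)$ is its quotient space by the equivalence relation generated by $x\sim x\circ\phi$, $\phi\in\mathsf{Rep}_+$ (trace equivalence). $h_*$ denotes the maps induced by $h$ on path spaces and on trace spaces. Normalization data: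 a continuous injective map $\iota:|C|\to(M,d)$ into a metric space and a triple $\mathfrak a=((\epsilon_n)_{n\ge1},(w_n)_{n\ge1},\theta)$ with $\epsilon_n>0$, $\epsilon_n\to0$, $w_n>0$, $\sum_nw_n<\infty$, and $\theta:[0,\infty[\to[0,1[$ continuous strictly increasing with $\theta(0)=0$. For $y:\mathbb I\to M$ continuous, $\operatorname{Var}_\epsilon(y,t)=\sup_{0=t_0<\cdots<t_r=t}\sum_i\max(d(y(t_{i-1}),y(t_i))-\epsilon,0)$ (zero at $t=0$), $L_y(t)=\sum_nw_n\theta(\operatorname{Var}_{\epsilon_n}(y,t))$. For a directed path $x$ of a timed space $(X,p)$, $\ell_x(t)=L_{\iota\circ p\circ x}(t)$. For non-constant $x$, $\ell_x(1)>0$, $\lambda_x=\ell_x/\ell_x(1)\in\mathsf{Rep}_+$ has as fibres exactly the maximal intervals on which $x$ is constant, and $N_p(x)$ is the unique continuous path with $x=N_p(x)\circ\lambda_x$; it is directed. For constant $x$, $\lambda_x=\mathrm{id}_{\mathbb I}$, $N_p(x)=x$. Put $H_p(x,s)(t)=N_p(x)((1-s)\lambda_x(t)+st)$. Canonical lift: $N_p$ is invariant under trace equivalence, so it induces a section $j_p$ from traces to paths, $j_p([x])=N_p(x)$. For a path $x$, a trace $\tau$ and $s\in\mathbb I$, with $\tau=[x]$ when $s=0$, put $K_p(x,\tau,s)=j_p(\tau)\circ\eta_{x,s}$ with $\eta_{x,s}(t)=\dfrac{st+(1-s)\ell_x(t)}{s+(1-s)\ell_x(1)}$ when the denominator is positive,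 and $K_p(x,[x],0)=x$ when $x$ is constant. The canonical lift of $(a,B)$ is $\widetilde B(z,s)=K_p(a(z),B(z,s),s)$, a continuous map $Z\times\mathbb I\to\overrightarrow{\mathcal P}(X)(u,v)$ lifting $B$ and starting at $a$; similarly for $(Y,q)$. *)

theory Defs
  imports "HOL-Analysis.Analysis" "HOL-Homology.Simplices"
begin

section \<open>The two categories of spaces\<close>

text \<open>Spaces are the abstract topologies of the library; only the behaviour of a map on the
  topological space of its domain is relevant, unless it is declared extensional.\<close>

abbreviation unit_I :: "real set"
  where "unit_I \<equiv> {0..1}"

abbreviation simplex_space :: "nat \<Rightarrow> (nat \<Rightarrow> real) topology"
  where "simplex_space n \<equiv> subtopology (powertop_real UNIV) (standard_simplex n)"

definition k_Delta :: "'a topology \<Rightarrow> 'a topology" where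
  "k_Delta Y = topology (\<lambda>U. U \<subseteq> topspace Y \<and>
     (\<forall>n \<sigma>. continuous_map (simplex_space n) Y \<sigma> \<longrightarrow>
        openin (simplex_space n) {s \<in> topspace (simplex_space n). \<sigma> s \<in> U}))"

lemma istopology_preimages:
  "istopology (\<lambda>U. U \<subseteq> S \<and> (\<forall>f\<in>F. openin (T f) {s \<in> topspace (T f). g f s \<in> U}))"
  unfolding istopology_def
proof (intro conjI allI impI ballI; (elim conjE)?)
  fix A B
  assume "\<forall>f\<in>F. openin (T f) {s \<in> topspace (T f). g f s \<in> A}"
    and "\<forall>f\<in>F. openin (T f) {s \<in> topspace (T f). g f s \<in> B}"
  moreover fix f assume "f \<in> F"
  moreover have "{s \<in> topspace (T f). g f s \<in> A \<inter> B} =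
      {s \<in> topspace (T f). g f s \<in> A} \<inter> {s \<in> topspace (T f). g f s \<in> B}"
    by auto
  ultimately show "openin (T f) {s \<in> topspace (T f). g f s \<in> A \<inter> B}"
    by (simp add: openin_Int)
next
  fix \<K> f
  assume K: "\<forall>K\<in>\<K>. K \<subseteq> S \<and> (\<forall>f\<in>F. openin (T f) {s \<in> topspace (T f). g f s \<in> K})"
    and f: "f \<in> F"
  have "{s \<in> topspace (T f). g f s \<in> \<Union>\<K>} = (\<Union>K\<in>\<K>. {s \<in> topspace (T f). g f s \<in> K})"
    by auto
  moreover have "openin (T f) (\<Union>K\<in>\<K>. {s \<in> topspace (T f). g f s \<in> K})"
    using K f by (intro openin_Union) auto
  ultimately show "openin (T f) {s \<in> topspace (T f). g f s \<in> \<Union>\<K>}"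
    by simp
qed auto

lemma openin_k_Delta:
  "openin (k_Delta Y) U \<longleftrightarrow> U \<subseteq> topspace Y \<and>
     (\<forall>n \<sigma>. continuous_map (simplex_space n) Y \<sigma> \<longrightarrow>
        openin (simplex_space n) {s \<in> topspace (simplex_space n). \<sigma> s \<in> U})"
proof -
  have "istopology (\<lambda>U. U \<subseteq> topspace Y \<and>
      (\<forall>f\<in>{(n, \<sigma>). continuous_map (simplex_space n) Y \<sigma>}. openin (simplex_space (fst f))
        {s \<in> topspace (simplex_space (fst f)). snd f s \<in> U}))"
    by (rule istopology_preimages)
  then have "istopology (\<lambda>U. U \<subseteq> topspace Y \<and>
     (\<forall>n \<sigma>. continuous_map (simplex_space n) Y \<sigma> \<longrightarrow>
        openin (simplex_space n) {s \<in> topspace (simplex_space n). \<sigma> s \<in> U}))"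
    by (simp add: case_prod_unfold Ball_def)
  then show ?thesis
    unfolding k_Delta_def by (simp add: topology_inverse')
qed

definition Delta_generated :: "'a topology \<Rightarrow> bool"
  where "Delta_generated X \<longleftrightarrow> k_Delta X = X"

definition Delta_Hausdorff :: "'a topology \<Rightarrow> bool"
  where "Delta_Hausdorff X \<longleftrightarrow> (\<forall>g. pathin X g \<longrightarrow> closedin X (g ` unit_I))"

datatype top_choice = All_Delta_Generated | Delta_Hausdorff_Only

definition in_Top :: "top_choice \<Rightarrow> 'a topology \<Rightarrow> bool" where
  "in_Top T X \<longleftrightarrow> Delta_generated X \<and> (T = Delta_Hausdorff_Only \<longrightarrow> Delta_Hausdorff X)"

text \<open>The product \<open>Z \<times> \<I>\<close> in either category.\<close>

definition times_I :: "'z topology \<Rightarrow> ('z \<times> real) topology"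
  where "times_I Z = k_Delta (prod_topology Z (top_of_set unit_I))"

section \<open>Directed spaces\<close>

text \<open>A path is a function on the reals that is extensional on the unit interval, so that
  equality of paths is equality on the unit interval. Composites are therefore formed with
  \<^const>\<open>compose\<close>.\<close>

record 'a dspace =
  under :: "'a topology"
  dpaths :: "(real \<Rightarrow> 'a) set"

definition paths :: "'a topology \<Rightarrow> (real \<Rightarrow> 'a) set"
  where "paths X = {x \<in> extensional unit_I. pathin X x}"

definition path_concat :: "(real \<Rightarrow> 'a) \<Rightarrow> (real \<Rightarrow> 'a) \<Rightarrow> real \<Rightarrow> 'a" where
  "path_concat x y = (\<lambda>t\<in>unit_I. if t \<le> 1/2 then x (2 * t) else y (2 * t - 1))"

definition directed_space :: "top_choice \<Rightarrow> 'a dspace \<Rightarrow> bool" where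
  "directed_space T X \<longleftrightarrow>
     in_Top T (under X) \<and>
     dpaths X \<subseteq> paths (under X) \<and>
     (\<forall>u \<in> topspace (under X). (\<lambda>t\<in>unit_I. u) \<in> dpaths X) \<and>
     (\<forall>x \<in> dpaths X. \<forall>\<phi>. continuous_on unit_I \<phi> \<and> mono_on unit_I \<phi> \<and> \<phi> ` unit_I \<subseteq> unit_I \<longrightarrow>
        compose unit_I x \<phi> \<in> dpaths X) \<and>
     (\<forall>x \<in> dpaths X. \<forall>y \<in> dpaths X. x 1 = y 0 \<longrightarrow> path_concat x y \<in> dpaths X)"

definition directed_map :: "'a dspace \<Rightarrow> 'b dspace \<Rightarrow> ('a \<Rightarrow> 'b) \<Rightarrow> bool" where
  "directed_map X Y h \<longleftrightarrow>
     continuous_map (under X) (under Y) h \<and> (\<forall>x \<in> dpaths X. compose unit_I h x \<in> dpaths Y)"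

definition Rep_plus :: "(real \<Rightarrow> real) set" where
  "Rep_plus = {\<phi>. continuous_on unit_I \<phi> \<and> mono_on unit_I \<phi> \<and> \<phi> ` unit_I = unit_I}"

definition saturated :: "'a dspace \<Rightarrow> bool" where
  "saturated X \<longleftrightarrow>
     (\<forall>x \<in> paths (under X). \<forall>\<phi> \<in> Rep_plus. compose unit_I x \<phi> \<in> dpaths X \<longrightarrow> x \<in> dpaths X)"

definition regular_map :: "'a dspace \<Rightarrow> ('a \<Rightarrow> 'b) \<Rightarrow> bool" where
  "regular_map X p \<longleftrightarrow>
     (\<forall>x \<in> dpaths X. compose unit_I p x constant_on unit_I \<longrightarrow> x constant_on unit_I)"

section \<open>Clocks and timed spaces\<close>

definition metric_injection :: "'c topology \<Rightarrow> 'm set \<Rightarrow> ('m \<Rightarrow> 'm \<Rightarrow> real) \<Rightarrow> ('c \<Rightarrow> 'm) \<Rightarrow> bool" where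
  "metric_injection X M d \<iota> \<longleftrightarrow>
     Metric_space M d \<and> continuous_map X (Metric_space.mtopology M d) \<iota> \<and> inj_on \<iota> (topspace X)"

text \<open>The metric space is sought inside the type of the points of the clock. This is no
  restriction, as metrics can be pulled back along injections: see \<open>clockI\<close> below.\<close>

definition clock :: "top_choice \<Rightarrow> 'c dspace \<Rightarrow> bool" where
  "clock T C \<longleftrightarrow> directed_space T C \<and> (\<exists>(M :: 'c set) d \<iota>. metric_injection (under C) M d \<iota>)"

lemma clockI:
  assumes C: "directed_space T C" and \<iota>: "metric_injection (under C) M d \<iota>"
  shows "clock T C"
proof -
  let ?S = "topspace (under C)"
  let ?e = "\<lambda>a b. d (\<iota> a) (\<iota> b)"
  interpret Metric_space M d
    using \<iota> by (simp add: metric_injection_def)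
  have cont: "continuous_map (under C) mtopology \<iota>" and inj: "inj_on \<iota> ?S"
    using \<iota> by (auto simp: metric_injection_def)
  have M: "\<iota> a \<in> M" if "a \<in> ?S" for a
    using continuous_map_funspace[OF cont] that by auto
  interpret e: Metric_space ?S ?e
    using M inj by unfold_locales (auto simp: commute triangle inj_on_eq_iff)
  have "continuous_map (under C) e.mtopology id"
    unfolding e.continuous_map_to_metric
  proof (intro ballI allI impI)
    fix a and r :: real assume a: "a \<in> ?S" "r > 0"
    then obtain U where "openin (under C) U" "a \<in> U" "\<forall>b\<in>U. \<iota> b \<in> mball (\<iota> a) r"
      using cont unfolding continuous_map_to_metric by blast
    then show "\<exists>U. openin (under C) U \<and> a \<in> U \<and> (\<forall>b\<in>U. id b \<in> e.mball (id a) r)"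
      using a by (intro exI[of _ U]) (auto simp: in_mball dest: openin_subset)
  qed
  then have "metric_injection (under C) ?S ?e id"
    by (simp add: metric_injection_def e.Metric_space_axioms)
  with C show ?thesis
    unfolding clock_def by blast
qed

definition timed_space :: "top_choice \<Rightarrow> 'c dspace \<Rightarrow> 'a dspace \<Rightarrow> ('a \<Rightarrow> 'c) \<Rightarrow> bool" where
  "timed_space T C X p \<longleftrightarrow>
     clock T C \<and> directed_space T X \<and> saturated X \<and> directed_map X C p \<and> regular_map X p"

definition timed_morphism ::
    "'a dspace \<Rightarrow> ('a \<Rightarrow> 'c) \<Rightarrow> 'b dspace \<Rightarrow> ('b \<Rightarrow> 'c) \<Rightarrow> ('a \<Rightarrow> 'b) \<Rightarrow> bool" where
  "timed_morphism X p Y q h \<longleftrightarrow>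
     directed_map X Y h \<and> (\<forall>u \<in> topspace (under X). q (h u) = p u)"

section \<open>Path spaces and trace spaces\<close>

definition compact_open :: "'a topology \<Rightarrow> (real \<Rightarrow> 'a) topology" where
  "compact_open X = topology_generated_by
     {{x \<in> paths X. x ` K \<subseteq> U} | K U. compact K \<and> K \<subseteq> unit_I \<and> openin X U}"

definition dpaths_between :: "'a dspace \<Rightarrow> 'a \<Rightarrow> 'a \<Rightarrow> (real \<Rightarrow> 'a) set"
  where "dpaths_between X u v = {x \<in> dpaths X. x 0 = u \<and> x 1 = v}"

definition path_space :: "'a dspace \<Rightarrow> 'a \<Rightarrow> 'a \<Rightarrow> (real \<Rightarrow> 'a) topology" where
  "path_space X u v = k_Delta (subtopology (compact_open (under X)) (dpaths_between X u v))"

definition reparam_step :: "'a dspace \<Rightarrow> 'a \<Rightarrow> 'a \<Rightarrow> (real \<Rightarrow> 'a) \<Rightarrow> (real \<Rightarrow> 'a) \<Rightarrow> bool" where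
  "reparam_step X u v x y \<longleftrightarrow>
     x \<in> dpaths_between X u v \<and> y \<in> dpaths_between X u v \<and> (\<exists>\<phi> \<in> Rep_plus. y = compose unit_I x \<phi>)"

text \<open>The class of a path under trace equivalence.\<close>

definition trace_of :: "'a dspace \<Rightarrow> 'a \<Rightarrow> 'a \<Rightarrow> (real \<Rightarrow> 'a) \<Rightarrow> (real \<Rightarrow> 'a) set"
  where "trace_of X u v x = {y. equivclp (reparam_step X u v) x y}"

definition trace_space :: "'a dspace \<Rightarrow> 'a \<Rightarrow> 'a \<Rightarrow> (real \<Rightarrow> 'a) set topology" where
  "trace_space X u v = topology (\<lambda>U. U \<subseteq> trace_of X u v ` dpaths_between X u v \<and>
     openin (path_space X u v) {x \<in> topspace (path_space X u v). trace_of X u v x \<in> U})"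

lemma topspace_k_Delta [simp]: "topspace (k_Delta Y) = topspace Y"
proof -
  have "openin (k_Delta Y) (topspace Y)"
    unfolding openin_k_Delta
  proof (intro conjI allI impI)
    fix n \<sigma> assume "continuous_map (simplex_space n) Y \<sigma>"
    then have "{s \<in> topspace (simplex_space n). \<sigma> s \<in> topspace Y} = topspace (simplex_space n)"
      using continuous_map_image_subset_topspace by fastforce
    then show "openin (simplex_space n) {s \<in> topspace (simplex_space n). \<sigma> s \<in> topspace Y}"
      by (metis openin_topspace)
  qed simp
  then show ?thesis
    by (metis openin_k_Delta openin_subset openin_topspace subset_antisym)
qed

lemma topspace_compact_open: "topspace (compact_open X) = paths X"
proof -
  have "paths X = {x \<in> paths X. x ` {} \<subseteq> {}}"
    by auto
  then have "paths X \<in> {{x \<in> paths X. x ` K \<subseteq> U} | K U. compact K \<and> K \<subseteq> unit_I \<and> openin X U}"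
    using compact_empty openin_empty by blast
  then show ?thesis
    unfolding compact_open_def topology_generated_by_topspace by blast
qed

lemma topspace_path_space:
  assumes "directed_space T X"
  shows "topspace (path_space X u v) = dpaths_between X u v"
  using assms
  by (auto simp: path_space_def topspace_compact_open directed_space_def dpaths_between_def)

lemma openin_trace_space:
  "openin (trace_space X u v) U \<longleftrightarrow> U \<subseteq> trace_of X u v ` dpaths_between X u v \<and>
     openin (path_space X u v) {x \<in> topspace (path_space X u v). trace_of X u v x \<in> U}"
proof -
  have "istopology (\<lambda>U. U \<subseteq> trace_of X u v ` dpaths_between X u v \<and>
      (\<forall>f\<in>{()}. openin (path_space X u v) {x \<in> topspace (path_space X u v). trace_of X u v x \<in> U}))"
    by (rule istopology_preimages)
  then show ?thesis
    unfolding trace_space_def by (simp add: topology_inverse')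
qed

definition path_push :: "('a \<Rightarrow> 'b) \<Rightarrow> (real \<Rightarrow> 'a) \<Rightarrow> real \<Rightarrow> 'b"
  where "path_push h x = compose unit_I h x"

text \<open>The map from traces of \<open>X\<close> to traces of \<open>Y\<close> from \<open>u'\<close> to \<open>v'\<close> induced by \<open>h\<close>:
  the common value on all representatives.\<close>

definition trace_push ::
    "'b dspace \<Rightarrow> 'b \<Rightarrow> 'b \<Rightarrow> ('a \<Rightarrow> 'b) \<Rightarrow> (real \<Rightarrow> 'a) set \<Rightarrow> (real \<Rightarrow> 'b) set" where
  "trace_push Y u' v' h \<tau> = the_elem ((\<lambda>x. trace_of Y u' v' (path_push h x)) ` \<tau>)"

section \<open>Normalization\<close>

text \<open>The values \<open>nd_eps 0\<close>, \<open>nd_w 0\<close> and those of \<open>nd_theta\<close> at negative numbers are not used.\<close>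

record ('c, 'm) norm_data =
  nd_space :: "'m set"
  nd_dist :: "'m \<Rightarrow> 'm \<Rightarrow> real"
  nd_emb :: "'c \<Rightarrow> 'm"
  nd_eps :: "nat \<Rightarrow> real"
  nd_w :: "nat \<Rightarrow> real"
  nd_theta :: "real \<Rightarrow> real"

definition normalization_data :: "'c dspace \<Rightarrow> ('c, 'm) norm_data \<Rightarrow> bool" where
  "normalization_data C D \<longleftrightarrow>
     metric_injection (under C) (nd_space D) (nd_dist D) (nd_emb D) \<and>
     (\<forall>n\<ge>1. nd_eps D n > 0) \<and> nd_eps D \<longlonglongrightarrow> 0 \<and>
     (\<forall>n\<ge>1. nd_w D n > 0) \<and> summable (nd_w D) \<and>
     continuous_on {0..} (nd_theta D) \<and> strict_mono_on {0..} (nd_theta D) \<and>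
     nd_theta D ` {0..} \<subseteq> {0..<1} \<and> nd_theta D 0 = 0"

text \<open>For continuous \<open>y\<close> and positive \<open>\<epsilon>\<close> the supremum is that of a bounded nonempty set
  (by uniform continuity); at \<open>t = 0\<close> the only subdivision has \<open>r = 0\<close>, so the value is 0.\<close>

definition Var :: "('m \<Rightarrow> 'm \<Rightarrow> real) \<Rightarrow> real \<Rightarrow> (real \<Rightarrow> 'm) \<Rightarrow> real \<Rightarrow> real" where
  "Var d \<epsilon> y t = Sup {(\<Sum>i<r. max (d (y (\<tau> i)) (y (\<tau> (Suc i))) - \<epsilon>) 0) | r \<tau>.
     \<tau> 0 = 0 \<and> \<tau> r = t \<and> (\<forall>i<r. \<tau> i < \<tau> (Suc i))}"

definition Lfun :: "('c, 'm) norm_data \<Rightarrow> (real \<Rightarrow> 'm) \<Rightarrow> real \<Rightarrow> real" where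
  "Lfun D y t =
     suminf (\<lambda>n. nd_w D (Suc n) * nd_theta D (Var (nd_dist D) (nd_eps D (Suc n)) y t))"

definition ell :: "('c, 'm) norm_data \<Rightarrow> ('a \<Rightarrow> 'c) \<Rightarrow> (real \<Rightarrow> 'a) \<Rightarrow> real \<Rightarrow> real" where
  "ell D p x t = Lfun D (nd_emb D \<circ> p \<circ> x) t"

definition lam :: "('c, 'm) norm_data \<Rightarrow> ('a \<Rightarrow> 'c) \<Rightarrow> (real \<Rightarrow> 'a) \<Rightarrow> real \<Rightarrow> real" where
  "lam D p x t = (if x constant_on unit_I then t else ell D p x t / ell D p x 1)"

definition npath ::
    "('c, 'm) norm_data \<Rightarrow> 'a dspace \<Rightarrow> ('a \<Rightarrow> 'c) \<Rightarrow> (real \<Rightarrow> 'a) \<Rightarrow> real \<Rightarrow> 'a" where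
  "npath D X p x = (if x constant_on unit_I then x
     else THE y. y \<in> paths (under X) \<and> x = compose unit_I y (lam D p x))"

definition Hpath ::
    "('c, 'm) norm_data \<Rightarrow> 'a dspace \<Rightarrow> ('a \<Rightarrow> 'c) \<Rightarrow> (real \<Rightarrow> 'a) \<Rightarrow> real \<Rightarrow> real \<Rightarrow> 'a" where
  "Hpath D X p x s = (\<lambda>t\<in>unit_I. npath D X p x ((1 - s) * lam D p x t + s * t))"

section \<open>Canonical lifts\<close>

text \<open>The common value of the normalization on all representatives of a trace.\<close>

definition jsec ::
    "('c, 'm) norm_data \<Rightarrow> 'a dspace \<Rightarrow> ('a \<Rightarrow> 'c) \<Rightarrow> (real \<Rightarrow> 'a) set \<Rightarrow> real \<Rightarrow> 'a" where
  "jsec D X p \<tau> = the_elem (npath D X p ` \<tau>)"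

definition eta :: "('c, 'm) norm_data \<Rightarrow> ('a \<Rightarrow> 'c) \<Rightarrow> (real \<Rightarrow> 'a) \<Rightarrow> real \<Rightarrow> real \<Rightarrow> real" where
  "eta D p x s t = (s * t + (1 - s) * ell D p x t) / (s + (1 - s) * ell D p x 1)"

text \<open>The denominator of \<^const>\<open>eta\<close> vanishes only for \<open>s = 0\<close> and constant \<open>x\<close>.\<close>

definition Kpath :: "('c, 'm) norm_data \<Rightarrow> 'a dspace \<Rightarrow> ('a \<Rightarrow> 'c) \<Rightarrow> (real \<Rightarrow> 'a) \<Rightarrow>
    (real \<Rightarrow> 'a) set \<Rightarrow> real \<Rightarrow> real \<Rightarrow> 'a" where
  "Kpath D X p x \<tau> s =
     (if s + (1 - s) * ell D p x 1 > 0 then compose unit_I (jsec D X p \<tau>) (eta D p x s) else x)"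

definition canonical_lift :: "('c, 'm) norm_data \<Rightarrow> 'a dspace \<Rightarrow> ('a \<Rightarrow> 'c) \<Rightarrow>
    ('z \<Rightarrow> real \<Rightarrow> 'a) \<Rightarrow> ('z \<times> real \<Rightarrow> (real \<Rightarrow> 'a) set) \<Rightarrow> 'z \<times> real \<Rightarrow> real \<Rightarrow> 'a" where
  "canonical_lift D X p a B = (\<lambda>(z, s). Kpath D X p (a z) (B (z, s)) s)"

end

theory Submission
  imports Defs
begin

text \<open>The length function of a directed path only depends on its projection to the clock, so it is
  the same for \<open>x\<close> and \<open>h \<circ> x\<close>, and regularity makes \<open>x\<close> constant exactly when \<open>h \<circ> x\<close> is. Since
  \<open>\<lambda>\<^sub>x\<close> is a continuous surjection of the interval whose fibres are collapsed by \<open>x\<close>, the path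
  \<open>N\<^sub>p(x)\<close> is characterised by \<open>x = N\<^sub>p(x) \<circ> \<lambda>\<^sub>x\<close>, and \<open>h \<circ> N\<^sub>p(x)\<close> has the property that
  characterises \<open>N\<^sub>q(h \<circ> x)\<close>. Invariance of the truncated variation under reparametrization makes
  normalization a function of the trace, and all other constructions are composites of these.\<close>

section \<open>Subdivisions and the values of a path that enter the truncated variation\<close>

lemma increasing_subdivision:
  fixes \<tau> :: "nat \<Rightarrow> real"
  assumes "\<And>i. i < r \<Longrightarrow> \<tau> i < \<tau> (Suc i)" and "i \<le> j" "j \<le> r"
  shows "\<tau> i \<le> \<tau> j"
  using assms(2,3)
proof (induction j rule: dec_induct)
  case (step n)
  then show ?case
    using assms(1)[of n] by simp
qed simp

text \<open>All points of a subdivision lie in [0, t]. This makes it possible to exchange composites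
  formed with \<open>compose\<close> and with \<open>\<circ>\<close>, which may differ outside the
  unit interval.\<close>

lemma Var_cong:
  assumes "\<And>s. 0 \<le> s \<Longrightarrow> s \<le> t \<Longrightarrow> y s = y' s"
  shows "Var d \<epsilon> y t = Var d \<epsilon> y' t"
proof -
  have "(\<Sum>i<r. max (d (y (\<tau> i)) (y (\<tau> (Suc i))) - \<epsilon>) 0) =
      (\<Sum>i<r. max (d (y' (\<tau> i)) (y' (\<tau> (Suc i))) - \<epsilon>) 0)"
    if \<tau>: "\<tau> 0 = 0" "\<tau> r = t" "\<forall>i<r. \<tau> i < \<tau> (Suc i)" for r \<tau>
  proof -
    have "y (\<tau> i) = y' (\<tau> i)" if "i \<le> r" for i
      using assms[of "\<tau> i"] increasing_subdivision[of r \<tau> 0 i] increasing_subdivision[of r \<tau> i r]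
        \<tau> that by auto
    then show ?thesis
      by (intro sum.cong) auto
  qed
  then show ?thesis
    unfolding Var_def by (intro arg_cong[where f = Sup] Collect_cong ex_cong1) auto
qed

section \<open>The truncated variation of a path\<close>

locale metric_path = Metric_space M d for M :: "'m set" and d +
  fixes y :: "real \<Rightarrow> 'm"
  assumes path: "pathin mtopology y"
begin

text \<open>Replaces continuity into the abstract metric space by continuity of a real function on a
  compact square, from which uniform continuity and boundedness follow.\<close>

lemma continuous_dist:
  "continuous_on (unit_I \<times> unit_I) (\<lambda>(s, t). d (y s) (y t))"
proof -
  let ?I = "top_of_set unit_I"
  have y: "continuous_map ?I (mtopology_of (metric (M, d))) y"
    using path by (simp add: pathin_def)
  have "continuous_map (prod_topology ?I ?I) euclidean
      (\<lambda>z. mdist (metric (M, d)) ((y \<circ> fst) z) ((y \<circ> snd) z))"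
    by (intro continuous_map_mdist continuous_map_compose[OF _ y] continuous_map_fst
        continuous_map_snd)
  then have "continuous_map (prod_topology ?I ?I) euclidean (\<lambda>z. d (y (fst z)) (y (snd z)))"
    by (simp add: o_def)
  moreover have "prod_topology ?I ?I = top_of_set (unit_I \<times> unit_I)"
    by (simp add: prod_topology_subtopology_eu)
  ultimately show ?thesis
    by (simp add: case_prod_unfold)
qed

lemma in_M: "t \<in> unit_I \<Longrightarrow> y t \<in> M"
  using path_image_subset_topspace[OF path] by (auto simp: Pi_iff)

lemma uniformly_continuous:
  assumes "e > 0"
  obtains \<delta> where "\<delta> > 0"
    "\<And>s t. s \<in> unit_I \<Longrightarrow> t \<in> unit_I \<Longrightarrow> \<bar>t - s\<bar> < \<delta> \<Longrightarrow> d (y s) (y t) < e"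
proof -
  have "uniformly_continuous_on (unit_I \<times> unit_I) (\<lambda>(s, t). d (y s) (y t))"
    by (intro compact_uniformly_continuous continuous_dist compact_Times) auto
  then obtain \<delta> where \<delta>: "\<delta> > 0"
    "\<And>a b a' b'. a \<in> unit_I \<Longrightarrow> b \<in> unit_I \<Longrightarrow> a' \<in> unit_I \<Longrightarrow> b' \<in> unit_I \<Longrightarrow>
       dist (a', b') (a, b) < \<delta> \<Longrightarrow> dist (d (y a') (y b')) (d (y a) (y b)) < e"
    using assms unfolding uniformly_continuous_on_def by (force simp: split_beta)
  show thesis
  proof (rule that[OF \<delta>(1)])
    fix s t :: real assume st: "s \<in> unit_I" "t \<in> unit_I" "\<bar>t - s\<bar> < \<delta>"
    \<comment> \<open>The comparison point is (s, s) on the diagonal, where the distance function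
      vanishes.\<close>
    then have "dist (s, t) (s, s) < \<delta>"
      by (simp add: dist_Pair_Pair dist_real_def)
    from \<delta>(2)[OF st(1) st(1) st(1) st(2) this] show "d (y s) (y t) < e"
      using in_M[OF st(1)] by (auto simp: dist_real_def)
  qed
qed

definition excess :: "real \<Rightarrow> real \<Rightarrow> real \<Rightarrow> real"
  where "excess \<epsilon> s t = max (d (y s) (y t) - \<epsilon>) 0"

lemma excess_nonneg: "0 \<le> excess \<epsilon> s t"
  by (simp add: excess_def)

text \<open>Below a gap \<open>\<delta>\<close> given by uniform continuity the excess vanishes; above it the diameter
  of the path divided by \<open>\<delta>\<close> is a Lipschitz constant.\<close>

lemma excess_linear_bound:
  assumes "\<epsilon> > 0"
  obtains K where "K \<ge> 0"
    "\<And>s t. 0 \<le> s \<Longrightarrow> s \<le> t \<Longrightarrow> t \<le> 1 \<Longrightarrow> excess \<epsilon> s t \<le> K * (t - s)"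
proof -
  obtain \<delta> where \<delta>: "\<delta> > 0"
    "\<And>s t. s \<in> unit_I \<Longrightarrow> t \<in> unit_I \<Longrightarrow> \<bar>t - s\<bar> < \<delta> \<Longrightarrow> d (y s) (y t) < \<epsilon>"
    using uniformly_continuous[OF assms] by blast
  have "compact ((\<lambda>(s, t). d (y s) (y t)) ` (unit_I \<times> unit_I))"
    by (intro compact_continuous_image continuous_dist compact_Times) auto
  then have "bounded ((\<lambda>(s, t). d (y s) (y t)) ` (unit_I \<times> unit_I))"
    by (rule compact_imp_bounded)
  then obtain R where R: "R > 0" "\<And>s t. s \<in> unit_I \<Longrightarrow> t \<in> unit_I \<Longrightarrow> d (y s) (y t) \<le> R"
    unfolding bounded_pos by (auto simp: abs_le_iff)
  show thesis
  proof (rule that[of "R / \<delta>"])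
    fix s t :: real assume st: "0 \<le> s" "s \<le> t" "t \<le> 1"
    show "excess \<epsilon> s t \<le> R / \<delta> * (t - s)"
    proof (cases "t - s < \<delta>")
      case True
      then have "excess \<epsilon> s t = 0"
        using \<delta>(2)[of s t] st by (simp add: excess_def)
      then show ?thesis
        using st R \<delta> by simp
    next
      case False
      then have "R * \<delta> \<le> R * (t - s)"
        using R by (intro mult_left_mono) auto
      then have "R \<le> R / \<delta> * (t - s)"
        using \<delta> by (simp add: field_simps)
      moreover have "excess \<epsilon> s t \<le> R"
        using R(1) R(2)[of s t] st assms by (simp add: excess_def)
      ultimately show ?thesis
        by simp
    qed
  qed (use R \<delta> in simp)
qed

text \<open>The linear bounds telescope. The resulting bound depends only on the end point, so the
  supremum in \<open>Var\<close> is that of a bounded set.\<close>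

lemma sum_excess_le:
  assumes K: "\<And>a b. 0 \<le> a \<Longrightarrow> a \<le> b \<Longrightarrow> b \<le> 1 \<Longrightarrow> excess \<epsilon> a b \<le> K * (b - a)"
    and \<tau>: "\<tau> 0 = 0" "\<tau> r \<le> 1" "\<And>i. i < r \<Longrightarrow> \<tau> i < \<tau> (Suc i)"
  shows "(\<Sum>i<r. excess \<epsilon> (\<tau> i) (\<tau> (Suc i))) \<le> K * \<tau> r"
proof -
  have "excess \<epsilon> (\<tau> i) (\<tau> (Suc i)) \<le> K * (\<tau> (Suc i) - \<tau> i)" if "i < r" for i
    using increasing_subdivision[of r \<tau> 0 i] increasing_subdivision[of r \<tau> "Suc i" r] that \<tau>
    by (intro K) (auto simp: less_imp_le)
  then have "(\<Sum>i<r. excess \<epsilon> (\<tau> i) (\<tau> (Suc i))) \<le> (\<Sum>i<r. K * (\<tau> (Suc i) - \<tau> i))"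
    by (intro sum_mono) auto
  also have "\<dots> = K * (\<tau> r - \<tau> 0)"
    by (simp flip: sum_distrib_left add: sum_lessThan_telescope)
  finally show ?thesis
    using \<tau> by simp
qed

text \<open>\<open>Sup\<close> is an upper bound of a set of reals only if that set is bounded
  above; \<epsilon> > 0 ensures this through the linear bound.\<close>

lemma Var_upper:
  assumes "\<epsilon> > 0" "\<tau> 0 = 0" "\<tau> r \<le> 1" "\<And>i. i < r \<Longrightarrow> \<tau> i < \<tau> (Suc i)"
  shows "(\<Sum>i<r. excess \<epsilon> (\<tau> i) (\<tau> (Suc i))) \<le> Var d \<epsilon> y (\<tau> r)"
proof -
  obtain K where K: "\<And>a b. 0 \<le> a \<Longrightarrow> a \<le> b \<Longrightarrow> b \<le> 1 \<Longrightarrow> excess \<epsilon> a b \<le> K * (b - a)"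
    using excess_linear_bound[OF assms(1)] by metis
  show ?thesis
    unfolding Var_def excess_def
  proof (rule cSup_upper)
    show "bdd_above {(\<Sum>i<r'. max (d (y (\<sigma> i)) (y (\<sigma> (Suc i))) - \<epsilon>) 0) | r' \<sigma>.
       \<sigma> 0 = 0 \<and> \<sigma> r' = \<tau> r \<and> (\<forall>i<r'. \<sigma> i < \<sigma> (Suc i))}"
    proof (rule bdd_aboveI[of _ "K * \<tau> r"], safe)
      fix r' and \<sigma> :: "nat \<Rightarrow> real"
      assume "\<sigma> 0 = 0" "\<sigma> r' = \<tau> r" "\<forall>i<r'. \<sigma> i < \<sigma> (Suc i)"
      then show "(\<Sum>i<r'. max (d (y (\<sigma> i)) (y (\<sigma> (Suc i))) - \<epsilon>) 0) \<le> K * \<tau> r"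
        using sum_excess_le[OF K, of \<sigma> r'] assms(3) by (simp add: excess_def)
    qed
  next
    show "(\<Sum>i<r. max (d (y (\<tau> i)) (y (\<tau> (Suc i))) - \<epsilon>) 0) \<in>
      {(\<Sum>i<r'. max (d (y (\<sigma> i)) (y (\<sigma> (Suc i))) - \<epsilon>) 0) | r' \<sigma>.
       \<sigma> 0 = 0 \<and> \<sigma> r' = \<tau> r \<and> (\<forall>i<r'. \<sigma> i < \<sigma> (Suc i))}"
      using assms(2,4) by blast
  qed
qed

lemma Var_least:
  assumes "0 \<le> t"
    and "\<And>r \<tau>. \<tau> 0 = 0 \<Longrightarrow> \<tau> r = t \<Longrightarrow> (\<And>i. i < r \<Longrightarrow> \<tau> i < \<tau> (Suc i)) \<Longrightarrow>
           (\<Sum>i<r. excess \<epsilon> (\<tau> i) (\<tau> (Suc i))) \<le> B"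
  shows "Var d \<epsilon> y t \<le> B"
  unfolding Var_def
proof (rule cSup_least)
  \<comment> \<open>For the supremum to be a least upper bound the set must be nonempty. The witness
    has the points 0 and t, or the single point 0 if t = 0, since subdivisions increase
    strictly.\<close>
  define \<tau> where "\<tau> i = (if i = 0 then 0 else t)" for i :: nat
  have "\<tau> 0 = 0" "\<tau> (if t = 0 then 0 else 1) = t"
    "\<forall>i < (if t = 0 then 0 else 1). \<tau> i < \<tau> (Suc i)"
    using assms(1) by (auto simp: \<tau>_def)
  then show "{(\<Sum>i<r. max (d (y (\<tau> i)) (y (\<tau> (Suc i))) - \<epsilon>) 0) | r \<tau>.
     \<tau> 0 = 0 \<and> \<tau> r = t \<and> (\<forall>i<r. \<tau> i < \<tau> (Suc i))} \<noteq> {}"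
    by blast
next
  fix b
  assume "b \<in> {(\<Sum>i<r. max (d (y (\<tau> i)) (y (\<tau> (Suc i))) - \<epsilon>) 0) | r \<tau>.
     \<tau> 0 = 0 \<and> \<tau> r = t \<and> (\<forall>i<r. \<tau> i < \<tau> (Suc i))}"
  then obtain r \<tau> where "b = (\<Sum>i<r. excess \<epsilon> (\<tau> i) (\<tau> (Suc i)))"
    and "\<tau> 0 = 0" "\<tau> r = t" "\<forall>i<r. \<tau> i < \<tau> (Suc i)"
    unfolding excess_def by blast
  then show "b \<le> B"
    using assms(2)[of \<tau> r] by blast
qed

lemma Var_nonneg:
  assumes "\<epsilon> > 0" "0 \<le> t" "t \<le> 1"
  shows "0 \<le> Var d \<epsilon> y t"
proof (cases "t = 0")
  case True
  then show ?thesis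
    using Var_upper[OF assms(1), of "\<lambda>_. 0" 0] by simp
next
  case False
  then have "(\<Sum>i<1. excess \<epsilon> (if i = 0 then 0 else t) (if Suc i = 0 then 0 else t)) \<le> Var d \<epsilon> y t"
    using Var_upper[OF assms(1), of "\<lambda>i. if i = 0 then 0 else t" 1] assms by simp
  then show ?thesis
    using excess_nonneg[of \<epsilon> 0 t] by simp
qed

lemma Var_0: "\<epsilon> > 0 \<Longrightarrow> Var d \<epsilon> y 0 = 0"
proof (rule antisym)
  show "Var d \<epsilon> y 0 \<le> 0" if "\<epsilon> > 0"
  proof (rule Var_least)
    fix r and \<tau> :: "nat \<Rightarrow> real"
    assume \<tau>: "\<tau> 0 = 0" "\<tau> r = 0" "\<And>i. i < r \<Longrightarrow> \<tau> i < \<tau> (Suc i)"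
    \<comment> \<open>A strictly increasing subdivision from 0 to 0 has no interval.\<close>
    have "r = 0"
      using \<tau>(1,2) \<tau>(3)[of 0] increasing_subdivision[of r \<tau> 1 r] \<tau>(3) by (cases r) auto
    then show "(\<Sum>i<r. excess \<epsilon> (\<tau> i) (\<tau> (Suc i))) \<le> 0"
      by simp
  qed simp
qed (simp add: Var_nonneg)

text \<open>Every subdivision of [0, s] extends to one of [0, t] by appending t. Adding a single
  excess suffices for all later uses.\<close>

lemma Var_superadditive:
  assumes "\<epsilon> > 0" "0 \<le> s" "s \<le> t" "t \<le> 1"
  shows "Var d \<epsilon> y s + excess \<epsilon> s t \<le> Var d \<epsilon> y t"
proof (cases "s = t")
  \<comment> \<open>Appending a point needs s < t; here the excess is 0 because the distance
    is.\<close>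
  case True
  then show ?thesis
    using assms in_M[of t] by (simp add: excess_def)
next
  case False
  have "Var d \<epsilon> y s \<le> Var d \<epsilon> y t - excess \<epsilon> s t"
  proof (rule Var_least)
    fix r and \<tau> :: "nat \<Rightarrow> real"
    assume \<tau>: "\<tau> 0 = 0" "\<tau> r = s" "\<And>i. i < r \<Longrightarrow> \<tau> i < \<tau> (Suc i)"
    define \<tau>' where "\<tau>' = \<tau>(Suc r := t)"
    have "(\<Sum>i<Suc r. excess \<epsilon> (\<tau>' i) (\<tau>' (Suc i))) \<le> Var d \<epsilon> y (\<tau>' (Suc r))"
      using \<tau> False assms by (intro Var_upper) (auto simp: \<tau>'_def less_Suc_eq)
    then show "(\<Sum>i<r. excess \<epsilon> (\<tau> i) (\<tau> (Suc i))) \<le> Var d \<epsilon> y t - excess \<epsilon> s t"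
      using \<tau> by (simp add: \<tau>'_def)
  qed (use assms in auto)
  then show ?thesis
    by simp
qed

lemma Var_mono: "\<epsilon> > 0 \<Longrightarrow> 0 \<le> s \<Longrightarrow> s \<le> t \<Longrightarrow> t \<le> 1 \<Longrightarrow> Var d \<epsilon> y s \<le> Var d \<epsilon> y t"
  using Var_superadditive[of \<epsilon> s t] excess_nonneg[of \<epsilon> s t] by simp

text \<open>Splitting the crossing interval at \<open>s\<close> may lower the truncated sum, but by at most the
  oscillation \<open>W\<close> of the path on \<open>[s, t]\<close>.\<close>

lemma Var_le:
  assumes "\<epsilon> > 0" and st: "0 \<le> s" "s \<le> t" "t \<le> 1"
    and K: "\<And>a b. 0 \<le> a \<Longrightarrow> a \<le> b \<Longrightarrow> b \<le> 1 \<Longrightarrow> excess \<epsilon> a b \<le> K * (b - a)" "K \<ge> 0"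
    and W: "\<And>a. s \<le> a \<Longrightarrow> a \<le> t \<Longrightarrow> d (y s) (y a) \<le> W" "W \<ge> 0"
  shows "Var d \<epsilon> y t \<le> Var d \<epsilon> y s + W + K * (t - s)"
proof (rule Var_least)
  fix r and \<tau> :: "nat \<Rightarrow> real"
  assume \<tau>: "\<tau> 0 = 0" "\<tau> r = t" "\<And>i. i < r \<Longrightarrow> \<tau> i < \<tau> (Suc i)"
  have \<tau>_bounds: "0 \<le> \<tau> k \<and> \<tau> k \<le> t" if "k \<le> r" for k
    using increasing_subdivision[of r \<tau> 0 k] increasing_subdivision[of r \<tau> k r] \<tau> that
    by auto
  let ?S = "\<lambda>k. \<Sum>i<k. excess \<epsilon> (\<tau> i) (\<tau> (Suc i))"
  have upper: "?S k \<le> Var d \<epsilon> y (\<tau> k)" if "k \<le> r" for k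
    using that \<tau>_bounds[OF that] \<tau> st assms(1) by (intro Var_upper) auto
  \<comment> \<open>Bounding every partial sum that has reached s lets the induction isolate the
    single interval crossing s, which costs W; the later intervals are paid for by K.\<close>
  have "?S k \<le> Var d \<epsilon> y s + W + K * (\<tau> k - s)" if "k \<le> r" "\<tau> k \<ge> s" for k
    using that
  proof (induction k)
    \<comment> \<open>Here s = 0, because the first point 0 has already reached s.\<close>
    case 0
    then show ?case
      using \<tau> st W K Var_nonneg[OF assms(1), of s] by simp
  next
    case (Suc k)
    note b = \<tau>_bounds[of k] \<tau>_bounds[of "Suc k"] \<tau>(3)[of k]
    show ?case
    proof (cases "\<tau> k \<ge> s")
      case True
      then have "excess \<epsilon> (\<tau> k) (\<tau> (Suc k)) \<le> K * (\<tau> (Suc k) - \<tau> k)"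
        using b Suc.prems st by (intro K) auto
      with True Suc show ?thesis
        by (simp add: algebra_simps)
    next
      case False
      have "d (y (\<tau> k)) (y (\<tau> (Suc k))) \<le> d (y (\<tau> k)) (y s) + d (y s) (y (\<tau> (Suc k)))"
        using b Suc.prems st by (intro triangle in_M) auto
      then have "excess \<epsilon> (\<tau> k) (\<tau> (Suc k)) \<le> excess \<epsilon> (\<tau> k) s + W"
        using W(1)[of "\<tau> (Suc k)"] b Suc.prems W(2) by (auto simp: excess_def)
      moreover have "Var d \<epsilon> y (\<tau> k) + excess \<epsilon> (\<tau> k) s \<le> Var d \<epsilon> y s"
        using False b Suc.prems st by (intro Var_superadditive assms) auto
      moreover have "K * (\<tau> (Suc k) - s) \<ge> 0"
        using Suc.prems K by simp
      ultimately show ?thesis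
        using upper[of k] Suc.prems by simp
    qed
  qed
  from this[of r] show "?S r \<le> Var d \<epsilon> y s + W + K * (t - s)"
    using \<tau> st by simp
qed (use st in simp)

lemma continuous_Var:
  assumes "\<epsilon> > 0"
  shows "continuous_on unit_I (Var d \<epsilon> y)"
proof -
  obtain K where K: "K \<ge> 0"
    "\<And>a b. 0 \<le> a \<Longrightarrow> a \<le> b \<Longrightarrow> b \<le> 1 \<Longrightarrow> excess \<epsilon> a b \<le> K * (b - a)"
    using excess_linear_bound[OF assms] by metis
  have "\<exists>\<delta>>0. \<forall>t\<in>unit_I. dist t s < \<delta> \<longrightarrow> dist (Var d \<epsilon> y t) (Var d \<epsilon> y s) < e"
    if s: "s \<in> unit_I" and e: "e > 0" for s e
  proof -
    obtain \<delta> where \<delta>: "\<delta> > 0"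
      "\<And>s t. s \<in> unit_I \<Longrightarrow> t \<in> unit_I \<Longrightarrow> \<bar>t - s\<bar> < \<delta> \<Longrightarrow> d (y s) (y t) < e / 2"
      using uniformly_continuous[of "e / 2"] e by auto
    \<comment> \<open>Half of e is reserved for the oscillation and half for the linear term. The
      denominator has K + 1 because K may be 0.\<close>
    define \<delta>' where "\<delta>' = min \<delta> (e / (2 * (K + 1)))"
    have \<delta>': "\<delta>' > 0"
      using \<delta> K e by (simp add: \<delta>'_def)
    have close: "Var d \<epsilon> y b - Var d \<epsilon> y a < e"
      if ab: "0 \<le> a" "a \<le> b" "b \<le> 1" "b - a < \<delta>'" for a b
    proof -
      have "Var d \<epsilon> y b \<le> Var d \<epsilon> y a + e / 2 + K * (b - a)"
        using ab \<delta>(2)[of a] e by (intro Var_le assms K) (auto simp: \<delta>'_def less_imp_le)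
      moreover have "(K + 1) * (b - a) < e / 2"
        using ab K by (simp add: \<delta>'_def field_simps)
      then have "K * (b - a) < e / 2"
        using ab by (simp add: algebra_simps)
      ultimately show ?thesis
        by simp
    qed
    have "dist (Var d \<epsilon> y t) (Var d \<epsilon> y s) < e" if t: "t \<in> unit_I" "dist t s < \<delta>'" for t
    proof (cases "s \<le> t")
      case True
      then show ?thesis
        using close[of s t] Var_mono[OF assms, of s t] s t by (simp add: dist_real_def)
    next
      case False
      then show ?thesis
        using close[of t s] Var_mono[OF assms, of t s] s t by (simp add: dist_real_def)
    qed
    with \<delta>' show ?thesis
      by blast
  qed
  then show ?thesis
    unfolding continuous_on_iff by blast
qed

section \<open>Invariance of the truncated variation under reparametrization\<close>

lemma metric_path_reparam:
  assumes "continuous_on unit_I \<phi>" "\<phi> ` unit_I \<subseteq> unit_I"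
  shows "metric_path M d (y \<circ> \<phi>)"
proof unfold_locales
  have "continuous_map (top_of_set unit_I) (top_of_set unit_I) \<phi>"
    using assms by auto
  then show "pathin mtopology (y \<circ> \<phi>)"
    using path unfolding pathin_def by (rule continuous_map_compose)
qed

text \<open>Points of a subdivision are pushed forward along \<phi> for one inequality, and lifted
  through \<phi> by the intermediate value theorem for the other.\<close>

lemma Var_reparam:
  assumes \<phi>: "\<phi> \<in> Rep_plus" and t: "t \<in> unit_I" and "\<epsilon> > 0"
  shows "Var d \<epsilon> (y \<circ> \<phi>) t = Var d \<epsilon> y (\<phi> t)"
proof -
  have cont: "continuous_on unit_I \<phi>" and mono: "mono_on unit_I \<phi>" and im: "\<phi> ` unit_I = unit_I"
    using \<phi> by (auto simp: Rep_plus_def)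
  interpret r: metric_path M d "y \<circ> \<phi>"
    using metric_path_reparam cont im by simp
  have excess: "r.excess \<epsilon> a b = excess \<epsilon> (\<phi> a) (\<phi> b)" for a b
    unfolding r.excess_def excess_def by simp
  have range: "0 \<le> \<phi> s \<and> \<phi> s \<le> 1" if "0 \<le> s" "s \<le> 1" for s
    using im that by force
  have le: "\<phi> a \<le> \<phi> b" if "0 \<le> a" "a \<le> b" "b \<le> 1" for a b
    using that mono by (auto simp: mono_on_def)
  \<comment> \<open>A monotone surjection of the interval fixes 0.\<close>
  obtain a where "a \<in> unit_I" "\<phi> a = 0"
    using im by (metis atLeastAtMost_iff imageE order_refl zero_le_one)
  then have \<phi>0: "\<phi> 0 = 0"
    using le[of 0 a] range[of 0] by auto
  show ?thesis
  proof (rule antisym)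
    show "Var d \<epsilon> (y \<circ> \<phi>) t \<le> Var d \<epsilon> y (\<phi> t)"
    proof (rule r.Var_least)
      fix r and \<tau> :: "nat \<Rightarrow> real"
      assume \<tau>: "\<tau> 0 = 0" "\<tau> r = t" "\<And>i. i < r \<Longrightarrow> \<tau> i < \<tau> (Suc i)"
      have \<tau>_bounds: "0 \<le> \<tau> k \<and> \<tau> k \<le> 1" if "k \<le> r" for k
        using increasing_subdivision[of r \<tau> 0 k] increasing_subdivision[of r \<tau> k r] \<tau> t that
        by auto
      \<comment> \<open>\<phi> may identify consecutive points, so the images need not form a strict
        subdivision. Superadditivity also covers equal points and avoids removing
        repetitions.\<close>
      have "(\<Sum>i<k. r.excess \<epsilon> (\<tau> i) (\<tau> (Suc i))) \<le> Var d \<epsilon> y (\<phi> (\<tau> k))" if "k \<le> r" for k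
        using that
      proof (induction k)
        case 0
        then show ?case
          using \<tau> \<phi>0 Var_0[OF assms(3)] by simp
      next
        case (Suc k)
        have "Var d \<epsilon> y (\<phi> (\<tau> k)) + excess \<epsilon> (\<phi> (\<tau> k)) (\<phi> (\<tau> (Suc k))) \<le> Var d \<epsilon> y (\<phi> (\<tau> (Suc k)))"
          using \<tau>_bounds[of k] \<tau>_bounds[of "Suc k"] \<tau>(3)[of k] Suc.prems
          by (intro Var_superadditive assms le) (auto simp: range)
        then show ?case
          using Suc unfolding excess by simp
      qed
      from this[of r] show "(\<Sum>i<r. r.excess \<epsilon> (\<tau> i) (\<tau> (Suc i))) \<le> Var d \<epsilon> y (\<phi> t)"
        using \<tau> by simp
    qed (use t in simp)
  next
    show "Var d \<epsilon> y (\<phi> t) \<le> Var d \<epsilon> (y \<circ> \<phi>) t"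
    proof (rule Var_least)
      fix r and \<tau> :: "nat \<Rightarrow> real"
      assume \<tau>: "\<tau> 0 = 0" "\<tau> r = \<phi> t" "\<And>i. i < r \<Longrightarrow> \<tau> i < \<tau> (Suc i)"
      \<comment> \<open>The preimage s of \<tau> k is arbitrary, since the induction step chooses
        its own preimage of the preceding point.\<close>
      have "(\<Sum>i<k. excess \<epsilon> (\<tau> i) (\<tau> (Suc i))) \<le> Var d \<epsilon> (y \<circ> \<phi>) s"
        if "k \<le> r" "s \<in> unit_I" "\<phi> s = \<tau> k" for k s
        using that
      proof (induction k arbitrary: s)
        case 0
        then have "0 \<le> Var d \<epsilon> (y \<circ> \<phi>) s"
          by (intro r.Var_nonneg assms) auto
        then show ?case
          by (simp add: o_def)
      next
        case (Suc k)
        have "0 \<le> \<tau> k" "\<tau> k \<le> \<tau> (Suc k)"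
          using increasing_subdivision[of r \<tau> 0 k] \<tau>(1,3) Suc.prems
            less_imp_le[OF \<tau>(3)[of k]] by auto
        \<comment> \<open>Applying the intermediate value theorem on [0, s] keeps the new preimage
          to the left of s.\<close>
        then obtain s' where s': "0 \<le> s'" "s' \<le> s" "\<phi> s' = \<tau> k"
          using IVT'[of \<phi> 0 "\<tau> k" s] \<phi>0 Suc.prems continuous_on_subset[OF cont, of "{0..s}"] by auto
        have "Var d \<epsilon> (y \<circ> \<phi>) s' + r.excess \<epsilon> s' s \<le> Var d \<epsilon> (y \<circ> \<phi>) s"
          using s' Suc.prems by (intro r.Var_superadditive assms) auto
        moreover have "(\<Sum>i<k. excess \<epsilon> (\<tau> i) (\<tau> (Suc i))) \<le> Var d \<epsilon> (y \<circ> \<phi>) s'"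
          using s' Suc.prems by (intro Suc.IH) auto
        ultimately show ?case
          using s' Suc.prems unfolding excess by (simp add: o_def)
      qed
      from this[of r t] show "(\<Sum>i<r. excess \<epsilon> (\<tau> i) (\<tau> (Suc i))) \<le> Var d \<epsilon> (y \<circ> \<phi>) t"
        using \<tau> t by simp
    qed (use range t in auto)
  qed
qed

end

lemma Lfun_cong:
  assumes "\<And>s. 0 \<le> s \<Longrightarrow> s \<le> t \<Longrightarrow> y s = y' s"
  shows "Lfun D y t = Lfun D y' t"
  unfolding Lfun_def using Var_cong[OF assms] by simp

section \<open>The length function of a path\<close>

text \<open>The conditions on the normalization data that do not mention the clock, together with a
  path in the metric space. Indices start at 1, whence \<open>Suc n\<close>, as in
  \<open>Lfun\<close>.\<close>

locale weighted_path = metric_path "nd_space D" "nd_dist D" y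
  for D :: "('c, 'm) norm_data" and y +
  assumes eps_pos: "\<And>n. nd_eps D (Suc n) > 0" and eps_lim: "nd_eps D \<longlonglongrightarrow> 0"
    and w_pos: "\<And>n. nd_w D (Suc n) > 0" and w_summable: "summable (nd_w D)"
    and theta_cont: "continuous_on {0..} (nd_theta D)"
    and theta_mono: "strict_mono_on {0..} (nd_theta D)"
    and theta_range: "nd_theta D ` {0..} \<subseteq> {0..<1}" and theta_0: "nd_theta D 0 = 0"
begin

abbreviation V :: "nat \<Rightarrow> real \<Rightarrow> real"
  where "V n \<equiv> Var (nd_dist D) (nd_eps D (Suc n)) y"

abbreviation Lterm :: "nat \<Rightarrow> real \<Rightarrow> real"
  where "Lterm n t \<equiv> nd_w D (Suc n) * nd_theta D (V n t)"

lemma V_nonneg: "t \<in> unit_I \<Longrightarrow> 0 \<le> V n t"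
  using Var_nonneg[OF eps_pos] by simp

text \<open>The values of \<open>nd_theta D\<close> lie below 1, so the weights dominate the series
  uniformly in t. Summability and uniform convergence both rest on this.\<close>

lemma Lterm_bounds: "t \<in> unit_I \<Longrightarrow> 0 \<le> Lterm n t \<and> Lterm n t \<le> nd_w D (Suc n)"
proof -
  assume "t \<in> unit_I"
  then have "nd_theta D (V n t) \<in> {0..<1}"
    using theta_range V_nonneg[of t n] by auto
  then show ?thesis
    using w_pos[of n] mult_left_le[of "nd_theta D (V n t)" "nd_w D (Suc n)"] by simp
qed

lemma w_summable': "summable (\<lambda>n. nd_w D (Suc n))"
  using w_summable by (simp add: summable_Suc_iff)

lemma Lterm_summable: "t \<in> unit_I \<Longrightarrow> summable (\<lambda>n. Lterm n t)"
  by (rule summable_comparison_test'[OF w_summable', of 0])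
    (metis Lterm_bounds abs_of_nonneg real_norm_def)

lemma Lfun_0: "Lfun D y 0 = 0"
  by (simp add: Lfun_def Var_0[OF eps_pos] theta_0)

lemma Lterm_mono:
  assumes "0 \<le> s" "s \<le> t" "t \<le> 1"
  shows "Lterm n s \<le> Lterm n t"
proof (rule mult_left_mono)
  show "nd_theta D (V n s) \<le> nd_theta D (V n t)"
    using Var_mono[OF eps_pos assms] V_nonneg assms
    by (intro strict_mono_on_leD[OF theta_mono]) auto
qed (use w_pos[of n] in simp)

lemma Lfun_mono:
  assumes "0 \<le> s" "s \<le> t" "t \<le> 1"
  shows "Lfun D y s \<le> Lfun D y t"
  unfolding Lfun_def
proof (rule suminf_le)
  show "Lterm n s \<le> Lterm n t" for n
    by (rule Lterm_mono[OF assms])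
qed (use assms in \<open>auto intro: Lterm_summable\<close>)

text \<open>If y s and y t differ, some \<epsilon> of the sequence is smaller than their distance.
  For it the truncated variation, and with it the corresponding term of the series, increases
  strictly.\<close>

lemma Lfun_eq_imp_eq:
  assumes st: "0 \<le> s" "s \<le> t" "t \<le> 1" and eq: "Lfun D y s = Lfun D y t"
  shows "y s = y t"
proof (rule ccontr)
  assume "y s \<noteq> y t"
  then have "nd_dist D (y s) (y t) > 0"
    using in_M[of s] in_M[of t] st by auto
  with LIMSEQ_Suc[OF eps_lim] obtain n where n: "nd_eps D (Suc n) < nd_dist D (y s) (y t)"
    using order_tendstoD(2)[of _ 0] eventually_happens'[OF sequentially_bot] by metis
  then have "V n s < V n t"
    using Var_superadditive[OF eps_pos st, of n] by (simp add: excess_def)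
  then have "Lterm n s < Lterm n t"
    using strict_mono_onD[OF theta_mono, of "V n s" "V n t"] V_nonneg[of s n] V_nonneg[of t n]
      st w_pos[of n] by simp
  \<comment> \<open>No term decreases, so equal sums force every nonnegative difference to
    vanish.\<close>
  moreover have "(\<lambda>n. Lterm n t - Lterm n s) sums 0"
    using sums_diff[OF summable_sums[OF Lterm_summable[of t]] summable_sums[OF Lterm_summable[of s]]]
      st eq by (simp add: Lfun_def)
  then have "\<forall>n. Lterm n t - Lterm n s = 0"
    using suminf_eq_zero_iff[of "\<lambda>n. Lterm n t - Lterm n s"] Lterm_mono[OF st]
    by (auto simp: sums_iff)
  then have "Lterm n t - Lterm n s = 0" ..
  ultimately show False
    by simp
qed

text \<open>The partial sums are continuous and converge uniformly by the Weierstrass test with the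
  weights as majorants.\<close>

lemma continuous_Lfun: "continuous_on unit_I (Lfun D y)"
proof -
  have "continuous_on unit_I (\<lambda>t. nd_theta D (V n t))" for n
    using V_nonneg by (intro continuous_on_compose2[OF theta_cont continuous_Var[OF eps_pos]]) auto
  then have "\<forall>\<^sub>F n in sequentially. continuous_on unit_I (\<lambda>t. \<Sum>i<n. Lterm i t)"
    by (intro always_eventually allI continuous_intros)
  moreover have "uniform_limit unit_I (\<lambda>n t. \<Sum>i<n. Lterm i t)
      (\<lambda>t. suminf (\<lambda>i. Lterm i t)) sequentially"
    using Lterm_bounds by (intro Weierstrass_m_test[OF _ w_summable']) auto
  ultimately have "continuous_on unit_I (\<lambda>t. suminf (\<lambda>i. Lterm i t))"
    by (rule uniform_limit_theorem) simp
  then show ?thesis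
    by (simp add: Lfun_def[abs_def])
qed

lemma Lfun_reparam:
  assumes "\<phi> \<in> Rep_plus" "t \<in> unit_I"
  shows "Lfun D (y \<circ> \<phi>) t = Lfun D y (\<phi> t)"
  using assms by (simp add: Lfun_def Var_reparam eps_pos)

end

section \<open>Normalization of directed paths\<close>

lemma Rep_plus_maps: "\<phi> \<in> Rep_plus \<Longrightarrow> t \<in> unit_I \<Longrightarrow> \<phi> t \<in> unit_I"
  unfolding Rep_plus_def by blast

lemma paths_maps: "x \<in> paths X \<Longrightarrow> t \<in> unit_I \<Longrightarrow> x t \<in> topspace X"
  using path_image_subset_topspace[of X x] by (auto simp: paths_def Pi_iff)

lemma constant_on_compose_Rep_plus:
  assumes "\<phi> \<in> Rep_plus"
  shows "compose unit_I x \<phi> constant_on unit_I \<longleftrightarrow> x constant_on unit_I"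
proof
  assume "compose unit_I x \<phi> constant_on unit_I"
  then obtain c where c: "\<And>t. t \<in> unit_I \<Longrightarrow> x (\<phi> t) = c"
    by (auto simp: constant_on_def compose_def)
  have "x t = c" if "t \<in> unit_I" for t
    using assms that c unfolding Rep_plus_def by (metis (mono_tags, lifting) imageE mem_Collect_eq)
  then show "x constant_on unit_I"
    by (auto simp: constant_on_def)
next
  assume "x constant_on unit_I"
  then show "compose unit_I x \<phi> constant_on unit_I"
    using Rep_plus_maps[OF assms] by (auto simp: constant_on_def compose_def)
qed

locale normalized_timed_space =
  fixes T :: top_choice and C :: "'c dspace" and D :: "('c, 'm) norm_data"
    and X :: "'a dspace" and p :: "'a \<Rightarrow> 'c"
  assumes norm_data: "normalization_data C D" and timed: "timed_space T C X p"
begin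

lemma dpath_path: "x \<in> dpaths X \<Longrightarrow> x \<in> paths (under X)"
  using timed by (auto simp: timed_space_def directed_space_def)

lemma dpath_in: "x \<in> dpaths X \<Longrightarrow> t \<in> unit_I \<Longrightarrow> x t \<in> topspace (under X)"
  using dpath_path paths_maps by blast

lemma dpath_reparam:
  "x \<in> dpaths X \<Longrightarrow> continuous_on unit_I \<phi> \<Longrightarrow> mono_on unit_I \<phi> \<Longrightarrow> \<phi> ` unit_I \<subseteq> unit_I \<Longrightarrow>
     compose unit_I x \<phi> \<in> dpaths X"
  using timed by (simp add: timed_space_def directed_space_def)

lemma continuous_p: "continuous_map (under X) (under C) p"
  using timed by (simp add: timed_space_def directed_map_def)

lemma regular: "x \<in> dpaths X \<Longrightarrow> compose unit_I p x constant_on unit_I \<Longrightarrow> x constant_on unit_I"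
  using timed by (simp add: timed_space_def regular_map_def)

lemma weighted_path_clock:
  assumes "x \<in> dpaths X"
  shows "weighted_path D (nd_emb D \<circ> p \<circ> x)"
proof -
  have emb: "Metric_space (nd_space D) (nd_dist D)"
    "continuous_map (under C) (Metric_space.mtopology (nd_space D) (nd_dist D)) (nd_emb D)"
    using norm_data by (auto simp: normalization_data_def metric_injection_def)
  interpret Metric_space "nd_space D" "nd_dist D"
    by (fact emb)
  have "pathin (under X) x"
    using dpath_path[OF assms] by (simp add: paths_def)
  then have "pathin mtopology (nd_emb D \<circ> (p \<circ> x))"
    by (intro pathin_compose[OF _ emb(2)] pathin_compose[OF _ continuous_p])
  then show ?thesis
    using norm_data by unfold_locales (auto simp: normalization_data_def o_assoc)
qed

lemma ell_0: "x \<in> dpaths X \<Longrightarrow> ell D p x 0 = 0"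
  unfolding ell_def by (rule weighted_path.Lfun_0[OF weighted_path_clock])

lemma ell_mono:
  "x \<in> dpaths X \<Longrightarrow> 0 \<le> s \<Longrightarrow> s \<le> t \<Longrightarrow> t \<le> 1 \<Longrightarrow> ell D p x s \<le> ell D p x t"
  unfolding ell_def by (rule weighted_path.Lfun_mono[OF weighted_path_clock])

lemma ell_bounds:
  "x \<in> dpaths X \<Longrightarrow> t \<in> unit_I \<Longrightarrow> 0 \<le> ell D p x t \<and> ell D p x t \<le> ell D p x 1"
  using ell_mono[of x 0 t] ell_mono[of x t 1] ell_0 by auto

lemma continuous_ell: "x \<in> dpaths X \<Longrightarrow> continuous_on unit_I (ell D p x)"
  unfolding ell_def[abs_def] by (rule weighted_path.continuous_Lfun[OF weighted_path_clock])

lemma ell_reparam: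
  assumes x: "x \<in> dpaths X" and \<phi>: "\<phi> \<in> Rep_plus" and t: "t \<in> unit_I"
  shows "ell D p (compose unit_I x \<phi>) t = ell D p x (\<phi> t)"
proof -
  \<comment> \<open>The two composites agree on [0, t], which is all that \<open>Lfun\<close>
    sees.\<close>
  have "Lfun D (nd_emb D \<circ> p \<circ> compose unit_I x \<phi>) t = Lfun D (nd_emb D \<circ> p \<circ> x \<circ> \<phi>) t"
    using t by (intro Lfun_cong) (auto simp: compose_def)
  then show ?thesis
    unfolding ell_def using weighted_path.Lfun_reparam[OF weighted_path_clock[OF x] \<phi> t] by simp
qed

text \<open>If the length does not increase on an interval, the projection to the clock is constant
  there; regularity then applies to the path rescaled to that interval.\<close>

lemma ell_eq_imp_eq:
  assumes x: "x \<in> dpaths X" and st: "0 \<le> s" "s \<le> t" "t \<le> 1"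
    and eq: "ell D p x s = ell D p x t"
  shows "x s = x t"
proof -
  interpret w: weighted_path D "nd_emb D \<circ> p \<circ> x"
    by (rule weighted_path_clock[OF x])
  have inj: "inj_on (nd_emb D) (topspace (under C))"
    using norm_data by (simp add: normalization_data_def metric_injection_def)
  have p_const: "p (x r) = p (x s)" if "s \<le> r" "r \<le> t" for r
  proof -
    have "ell D p x s = ell D p x r"
      using ell_mono[OF x, of s r] ell_mono[OF x, of r t] that st eq by simp
    then have "nd_emb D (p (x s)) = nd_emb D (p (x r))"
      using w.Lfun_eq_imp_eq[of s r] that st by (simp add: ell_def)
    moreover have "p (x a) \<in> topspace (under C)" if "a \<in> unit_I" for a
      using continuous_map_funspace[OF continuous_p] dpath_in[OF x that] by auto
    ultimately show ?thesis
      using inj that st by (auto simp: inj_on_eq_iff)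
  qed
  define \<phi> where "\<phi> r = s + r * (t - s)" for r
  have \<phi>: "s \<le> \<phi> r \<and> \<phi> r \<le> t" if "r \<in> unit_I" for r
    using that st mult_left_le_one_le[of "t - s" r] by (auto simp: \<phi>_def)
  have "compose unit_I x \<phi> \<in> dpaths X"
  proof (rule dpath_reparam[OF x])
    show "continuous_on unit_I \<phi>"
      unfolding \<phi>_def by (intro continuous_intros)
    show "mono_on unit_I \<phi>"
      using st by (auto simp: mono_on_def \<phi>_def intro: mult_right_mono)
    show "\<phi> ` unit_I \<subseteq> unit_I"
      using \<phi> st by force
  qed
  moreover have "compose unit_I p (compose unit_I x \<phi>) constant_on unit_I"
    using p_const \<phi> unfolding constant_on_def compose_def by auto
  ultimately have "compose unit_I x \<phi> constant_on unit_I"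
    by (rule regular)
  then have "compose unit_I x \<phi> 0 = compose unit_I x \<phi> 1"
    by (auto simp: constant_on_def)
  then show ?thesis
    by (simp add: compose_def \<phi>_def)
qed

section \<open>The normalized parameter and the factorization through it\<close>

lemma ell_1_pos:
  assumes x: "x \<in> dpaths X" and "\<not> x constant_on unit_I"
  shows "ell D p x 1 > 0"
proof (rule ccontr)
  assume "\<not> ell D p x 1 > 0"
  \<comment> \<open>Without positive total length all lengths are squeezed to 0, and x would be
    constant.\<close>
  then have "ell D p x 0 = ell D p x t" if "t \<in> unit_I" for t
    using ell_bounds[OF x that] ell_0[OF x] by simp
  then have "x t = x 0" if "t \<in> unit_I" for t
    using ell_eq_imp_eq[OF x, of 0 t] that by auto
  then show False
    using assms(2) unfolding constant_on_def by blast
qed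

lemma lam_Rep_plus:
  assumes x: "x \<in> dpaths X"
  shows "lam D p x \<in> Rep_plus"
proof (cases "x constant_on unit_I")
  case True
  then have "lam D p x = (\<lambda>t. t)"
    by (auto simp: lam_def)
  then show ?thesis
    by (simp add: Rep_plus_def mono_on_def)
next
  case False
  then have lam: "lam D p x = (\<lambda>t. ell D p x t / ell D p x 1)"
    by (auto simp: lam_def)
  note pos = ell_1_pos[OF x False]
  have cont: "continuous_on unit_I (lam D p x)"
    unfolding lam using pos by (intro continuous_intros continuous_ell x) auto
  have "lam D p x ` unit_I \<subseteq> unit_I"
    using ell_bounds[OF x] pos by (auto simp: lam)
  \<comment> \<open>The quotient runs continuously from 0 to 1, so it takes every value
    between.\<close>
  moreover have "t \<in> lam D p x ` unit_I" if "t \<in> unit_I" for t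
    using IVT'[of "lam D p x" 0 t 1, OF _ _ _ cont] that pos ell_0[OF x] by (force simp: lam)
  ultimately show ?thesis
    using cont ell_mono[OF x] pos by (auto simp: Rep_plus_def mono_on_def lam divide_right_mono)
qed

text \<open>\<phi> fixes 1, so the total length is unchanged, and the lengths themselves are
  transported by \<phi>. For constant x both normalized parameters are the identity and the equation
  would say \<phi> t = t.\<close>

lemma lam_reparam:
  assumes x: "x \<in> dpaths X" "\<not> x constant_on unit_I" and \<phi>: "\<phi> \<in> Rep_plus" and t: "t \<in> unit_I"
  shows "lam D p (compose unit_I x \<phi>) t = lam D p x (\<phi> t)"
proof -
  have mono: "mono_on unit_I \<phi>" and im: "\<phi> ` unit_I = unit_I"
    using \<phi> by (auto simp: Rep_plus_def)
  have "1 \<in> \<phi> ` unit_I"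
    unfolding im by simp
  then obtain a where "a \<in> unit_I" "\<phi> a = 1"
    by auto
  then have "\<phi> 1 = 1"
    using mono_onD[OF mono, of a 1] Rep_plus_maps[OF \<phi>, of 1] by auto
  moreover have "\<not> compose unit_I x \<phi> constant_on unit_I"
    using x(2) constant_on_compose_Rep_plus[OF \<phi>] by blast
  ultimately show ?thesis
    using x(2) ell_reparam[OF x(1) \<phi> t] ell_reparam[OF x(1) \<phi>, of 1] by (simp add: lam_def)
qed

text \<open>\<open>lam D p x\<close> is surjective, so x determines every value of y on the
  interval; extensionality turns this into equality of functions, as the definite description
  requires.\<close>

lemma npath_unique:
  assumes x: "x \<in> dpaths X" "\<not> x constant_on unit_I"
    and y: "y \<in> paths (under X)" "x = compose unit_I y (lam D p x)"
  shows "npath D X p x = y"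
proof -
  have "z = y" if z: "z \<in> paths (under X)" "x = compose unit_I z (lam D p x)" for z
  proof (rule extensionalityI[of _ unit_I])
    fix t :: real assume "t \<in> unit_I"
    then have "t \<in> lam D p x ` unit_I"
      using lam_Rep_plus[OF x(1)] by (simp add: Rep_plus_def)
    then obtain s where s: "s \<in> unit_I" "t = lam D p x s"
      by blast
    have "x s = z t" "x s = y t"
      using fun_cong[OF z(2), of s] fun_cong[OF y(2), of s] s(1) unfolding s(2)
      by (auto simp only: compose_eq)
    then show "z t = y t"
      by simp
  qed (use y z in \<open>auto simp: paths_def\<close>)
  then have "(THE z. z \<in> paths (under X) \<and> x = compose unit_I z (lam D p x)) = y"
    using y by (intro the_equality) blast+
  then show ?thesis
    unfolding npath_def using x(2) by (simp only: if_False)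
qed

text \<open>x is constant on the fibres of the quotient map \<open>lam D p x\<close>, hence descends
  along it to a continuous path.\<close>

lemma npath_factorization:
  assumes x: "x \<in> dpaths X"
  shows "npath D X p x \<in> paths (under X)" "x = compose unit_I (npath D X p x) (lam D p x)"
proof -
  have xp: "x \<in> extensional unit_I" "pathin (under X) x"
    using dpath_path[OF x] by (auto simp: paths_def)
  have "npath D X p x \<in> paths (under X) \<and> x = compose unit_I (npath D X p x) (lam D p x)"
  proof (cases "x constant_on unit_I")
    case True
    then have "lam D p x = (\<lambda>t. t)" "npath D X p x = x"
      by (auto simp: lam_def npath_def)
    then show ?thesis
      using dpath_path[OF x] extensional_restrict[OF xp(1)] by (simp add: compose_def)
  next
    case False
    let ?I = "top_of_set unit_I"
    have cont: "continuous_on unit_I (lam D p x)" and im: "lam D p x ` unit_I = unit_I"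
      using lam_Rep_plus[OF x] by (auto simp: Rep_plus_def)
    \<comment> \<open>A continuous surjection from a compact space onto a Hausdorff space is a
      quotient map.\<close>
    have quot: "quotient_map ?I ?I (lam D p x)"
    proof (rule T1_Spaces.continuous_imp_quotient_map)
      show "continuous_map ?I ?I (lam D p x)"
        using cont im by auto
    qed (use im in \<open>auto simp: compact_space_subtopology Hausdorff_space_subtopology\<close>)
    have fibres: "x s = x t" if "s \<in> unit_I" "t \<in> unit_I" "lam D p x s = lam D p x t" for s t
    proof -
      have "ell D p x s = ell D p x t"
        using that False ell_1_pos[OF x False] by (simp add: lam_def)
      then show ?thesis
        using ell_eq_imp_eq[OF x, of s t] ell_eq_imp_eq[OF x, of t s] that(1,2)
        by (metis atLeastAtMost_iff linear)
    qed
    obtain g where g: "continuous_map ?I (under X) g" "\<And>t. t \<in> unit_I \<Longrightarrow> g (lam D p x t) = x t"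
    proof (rule quotient_map_lift_exists[OF quot xp(2)[unfolded pathin_def]])
      show "x s = x t" if "s \<in> topspace ?I" "t \<in> topspace ?I" "lam D p x s = lam D p x t" for s t
        using that by (intro fibres) auto
    qed (rule that, simp_all)
    \<comment> \<open>The lift g is undetermined off the interval; elements of \<open>paths\<close>
      must be extensional.\<close>
    have "restrict g unit_I \<in> paths (under X)"
      using continuous_map_eq[OF g(1), of "restrict g unit_I"] by (simp add: paths_def pathin_def)
    moreover have "x = compose unit_I (restrict g unit_I) (lam D p x)"
    proof (rule extensionalityI[OF xp(1)])
      show "x t = compose unit_I (restrict g unit_I) (lam D p x) t" if "t \<in> unit_I" for t
        using g(2)[OF that] Rep_plus_maps[OF lam_Rep_plus[OF x] that] that
        by (simp only: compose_eq restrict_apply')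
    qed simp
    moreover from calculation have "npath D X p x = restrict g unit_I"
      by (rule npath_unique[OF x False])
    ultimately show ?thesis
      by metis
  qed
  then show "npath D X p x \<in> paths (under X)" "x = compose unit_I (npath D X p x) (lam D p x)"
    by blast+
qed

section \<open>Invariance of the normalization under trace equivalence\<close>

lemma npath_reparam:
  assumes x: "x \<in> dpaths X" and \<phi>: "\<phi> \<in> Rep_plus"
  shows "npath D X p (compose unit_I x \<phi>) = npath D X p x"
proof (cases "x constant_on unit_I")
  case True
  then have "compose unit_I x \<phi> = x"
    using dpath_path[OF x] Rep_plus_maps[OF \<phi>]
    by (intro extensionalityI[of _ unit_I]) (auto simp: paths_def constant_on_def compose_def)
  then show ?thesis
    by simp
next
  case False
  have x\<phi>: "compose unit_I x \<phi> \<in> dpaths X"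
    using \<phi> by (intro dpath_reparam x) (auto simp: Rep_plus_def)
  \<comment> \<open>Substituting \<phi> t in the factorization of x factors the reparametrized path
    through its own normalized parameter, with the same outer path; uniqueness then applies.\<close>
  have "compose unit_I x \<phi> t = npath D X p x (lam D p (compose unit_I x \<phi>) t)"
    if "t \<in> unit_I" for t
    using fun_cong[OF npath_factorization(2)[OF x], of "\<phi> t"] that Rep_plus_maps[OF \<phi> that]
    by (simp only: compose_eq lam_reparam[OF x False \<phi> that])
  then have "compose unit_I x \<phi> =
      compose unit_I (npath D X p x) (lam D p (compose unit_I x \<phi>))"
    by (intro extensionalityI[of _ unit_I]) (auto simp: compose_eq)
  then show ?thesis
    using npath_unique[OF x\<phi>] False constant_on_compose_Rep_plus[OF \<phi>]
      npath_factorization(1)[OF x] by blast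
qed

lemma npath_trace:
  assumes "y \<in> trace_of X u v x"
  shows "npath D X p y = npath D X p x"
proof -
  have "equivclp (reparam_step X u v) x y"
    using assms by (simp add: trace_of_def)
  then show ?thesis
  proof (induction rule: equivclp_induct)
    case (step y z)
    then show ?case
      using npath_reparam by (auto simp: reparam_step_def dpaths_between_def)
  qed simp
qed

text \<open>The class contains x and normalization is constant on it, so \<open>the_elem\<close> is
  applied to a singleton.\<close>

lemma jsec_trace: "jsec D X p (trace_of X u v x) = npath D X p x"
proof -
  have "npath D X p ` trace_of X u v x = {npath D X p x}"
    using npath_trace by (fastforce simp: trace_of_def)
  then show ?thesis
    by (simp add: jsec_def)
qed

end

section \<open>Naturality\<close>

locale normalized_timed_morphism =
  X: normalized_timed_space T C D X p + Y: normalized_timed_space T C D Y q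
  for T :: top_choice and C :: "'c dspace" and D :: "('c, 'm) norm_data"
    and X :: "'a dspace" and p :: "'a \<Rightarrow> 'c" and Y :: "'b dspace" and q :: "'b \<Rightarrow> 'c" +
  fixes h :: "'a \<Rightarrow> 'b"
  assumes morphism: "timed_morphism X p Y q h"
begin

lemma push_dpath: "x \<in> dpaths X \<Longrightarrow> compose unit_I h x \<in> dpaths Y"
  using morphism by (simp add: timed_morphism_def directed_map_def)

lemma over_clock: "u \<in> topspace (under X) \<Longrightarrow> q (h u) = p u"
  using morphism by (simp add: timed_morphism_def)

lemma push_path:
  assumes "x \<in> paths (under X)"
  shows "compose unit_I h x \<in> paths (under Y)"
proof -
  have "pathin (under Y) (h \<circ> x)"
    using assms morphism
    by (auto simp: paths_def timed_morphism_def directed_map_def intro: pathin_compose)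
  then have "pathin (under Y) (compose unit_I h x)"
    unfolding pathin_def by (rule continuous_map_eq) (auto simp: compose_def)
  then show ?thesis
    by (simp add: paths_def)
qed

lemma ell_push:
  assumes "x \<in> dpaths X" "t \<in> unit_I"
  shows "ell D q (compose unit_I h x) t = ell D p x t"
  unfolding ell_def
proof (rule Lfun_cong)
  fix s assume "0 \<le> s" "s \<le> t"
  then have "s \<in> unit_I"
    using assms(2) by simp
  then show "(nd_emb D \<circ> q \<circ> compose unit_I h x) s = (nd_emb D \<circ> p \<circ> x) s"
    using X.dpath_in[OF assms(1)] by (simp add: compose_eq over_clock)
qed

text \<open>If h \<circ> x is constant, so is p \<circ> x = q \<circ> h \<circ> x, and p is regular.
  Thus the case distinctions in \<open>lam\<close> and \<open>npath\<close> agree on both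
  sides.\<close>

lemma constant_push:
  assumes x: "x \<in> dpaths X"
  shows "compose unit_I h x constant_on unit_I \<longleftrightarrow> x constant_on unit_I"
proof
  assume "compose unit_I h x constant_on unit_I"
  then obtain c where "\<And>t. t \<in> unit_I \<Longrightarrow> h (x t) = c"
    by (auto simp: constant_on_def compose_def)
  then have "compose unit_I p x constant_on unit_I"
    using over_clock[OF X.dpath_in[OF x]] unfolding constant_on_def compose_def
    by (intro exI[of _ "q c"]) auto
  then show "x constant_on unit_I"
    by (rule X.regular[OF x])
next
  assume "x constant_on unit_I"
  then show "compose unit_I h x constant_on unit_I"
    by (auto simp: constant_on_def compose_def)
qed

lemma lam_push:
  "x \<in> dpaths X \<Longrightarrow> t \<in> unit_I \<Longrightarrow> lam D q (compose unit_I h x) t = lam D p x t"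
  by (simp add: lam_def constant_push ell_push)

lemma npath_push:
  assumes x: "x \<in> dpaths X"
  shows "npath D Y q (compose unit_I h x) = compose unit_I h (npath D X p x)"
proof (cases "x constant_on unit_I")
  case True
  then show ?thesis
    using constant_push[OF x] by (simp add: npath_def)
next
  case False
  note N = X.npath_factorization[OF x]
  have "compose unit_I h x t = h (npath D X p x (lam D q (compose unit_I h x) t))"
    if "t \<in> unit_I" for t
    using fun_cong[OF N(2), of t] that by (simp only: compose_eq lam_push[OF x that])
  then have "compose unit_I h x =
      compose unit_I (compose unit_I h (npath D X p x)) (lam D q (compose unit_I h x))"
    using Rep_plus_maps[OF Y.lam_Rep_plus[OF push_dpath[OF x]]]
    by (intro extensionalityI[of _ unit_I]) (simp_all only: compose_eq compose_extensional)
  then show ?thesis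
    using Y.npath_unique[OF push_dpath[OF x]] constant_push[OF x] False push_path[OF N(1)] by blast
qed

lemma Hpath_push:
  assumes x: "x \<in> dpaths X" and s: "s \<in> unit_I"
  shows "Hpath D Y q (compose unit_I h x) s = compose unit_I h (Hpath D X p x s)"
proof (rule extensionalityI[of _ unit_I])
  fix t :: real assume t: "t \<in> unit_I"
  have "lam D p x t \<in> unit_I"
    by (rule Rep_plus_maps[OF X.lam_Rep_plus[OF x] t])
  \<comment> \<open>A convex combination stays in the interval, where \<open>compose\<close> really
    applies h.\<close>
  then have "(1 - s) * lam D p x t + s * t \<in> unit_I"
    using convexD[of unit_I "lam D p x t" t "1 - s" s] s t by simp
  then show "Hpath D Y q (compose unit_I h x) s t = compose unit_I h (Hpath D X p x s) t"
    using t x by (simp add: Hpath_def npath_push lam_push compose_eq)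
qed (auto simp: Hpath_def)

section \<open>Induced maps on traces and naturality of the lifts\<close>

lemma push_dpaths_between:
  "x \<in> dpaths_between X u v \<Longrightarrow> compose unit_I h x \<in> dpaths_between Y (h u) (h v)"
  by (auto simp: dpaths_between_def push_dpath compose_eq)

lemma reparam_step_push:
  assumes "reparam_step X u v x y"
  shows "reparam_step Y (h u) (h v) (compose unit_I h x) (compose unit_I h y)"
proof -
  obtain \<phi> where \<phi>: "\<phi> \<in> Rep_plus" "y = compose unit_I x \<phi>"
    using assms by (auto simp: reparam_step_def)
  then have "compose unit_I h y = compose unit_I (compose unit_I h x) \<phi>"
    using Rep_plus_maps[OF \<phi>(1)] by (intro extensionalityI[of _ unit_I]) (auto simp: compose_def)
  with \<phi>(1) show ?thesis
    using assms push_dpaths_between unfolding reparam_step_def by blast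
qed

text \<open>h carries each elementary reparametrization step to such a step, hence chains to chains.
  This makes the common value in \<open>trace_push\<close> well defined.\<close>

lemma trace_of_push:
  assumes "y \<in> trace_of X u v x"
  shows "trace_of Y (h u) (h v) (path_push h y) = trace_of Y (h u) (h v) (path_push h x)"
proof -
  have "equivclp (reparam_step X u v) x y"
    using assms by (simp add: trace_of_def)
  then have "equivclp (reparam_step Y (h u) (h v)) (compose unit_I h x) (compose unit_I h y)"
  proof (induction rule: equivclp_induct)
    case (step y z)
    then show ?case
      by (meson equivclp_into_equivclp reparam_step_push)
  qed simp
  then show ?thesis
    unfolding trace_of_def path_push_def by (blast intro: equivclp_trans equivclp_sym)
qed

lemma trace_push_trace_of:
  "trace_push Y (h u) (h v) h (trace_of X u v x) = trace_of Y (h u) (h v) (path_push h x)"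
proof -
  have "(\<lambda>y. trace_of Y (h u) (h v) (path_push h y)) ` trace_of X u v x =
      {trace_of Y (h u) (h v) (path_push h x)}"
    using trace_of_push by (fastforce simp: trace_of_def)
  then show ?thesis
    by (simp add: trace_push_def)
qed

lemma eta_push:
  "x \<in> dpaths X \<Longrightarrow> t \<in> unit_I \<Longrightarrow> eta D q (compose unit_I h x) s t = eta D p x s t"
  by (simp add: eta_def ell_push)

text \<open>Equal lengths give equal denominators and equal functions \<open>eta\<close>, so both
  sides take the same branch. The trace is given by a representative y, through which
  \<open>jsec\<close> becomes \<open>npath\<close>.\<close>

lemma Kpath_push:
  assumes x: "x \<in> dpaths X" and y: "y \<in> dpaths_between X u v" and s: "s \<in> unit_I"
  shows "path_push h (Kpath D X p x (trace_of X u v y) s) =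
    Kpath D Y q (path_push h x) (trace_push Y (h u) (h v) h (trace_of X u v y)) s"
proof (cases "s + (1 - s) * ell D p x 1 > 0")
  case True
  \<comment> \<open>The numerator lies between 0 and the denominator, so the composite with the
    section stays in the domain of the path.\<close>
  have "eta D p x s t \<in> unit_I" if "t \<in> unit_I" for t
  proof -
    note b = X.ell_bounds[OF x that]
    have "(1 - s) * ell D p x t \<le> (1 - s) * ell D p x 1" "s * t \<le> s"
      using b s that by (auto intro: mult_left_mono mult_left_le)
    then show ?thesis
      using True b s that by (simp add: eta_def)
  qed
  moreover have "npath D Y q (path_push h y) = compose unit_I h (npath D X p y)"
    using y npath_push by (simp add: path_push_def dpaths_between_def)
  ultimately have "compose unit_I h (compose unit_I (npath D X p y) (eta D p x s)) =
      compose unit_I (npath D Y q (path_push h y)) (eta D q (compose unit_I h x) s)"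
    by (intro extensionalityI[of _ unit_I]) (auto simp: compose_eq eta_push[OF x])
  then show ?thesis
    using True x
    by (simp add: Kpath_def trace_push_trace_of X.jsec_trace Y.jsec_trace path_push_def ell_push)
next
  case False
  then show ?thesis
    using x by (simp add: Kpath_def path_push_def ell_push)
qed

end

theorem proposition9p1:
  fixes T :: top_choice
    and C :: "'c dspace" and D :: "('c, 'm) norm_data"
    and X :: "'a dspace" and p :: "'a \<Rightarrow> 'c"
    and Y :: "'b dspace" and q :: "'b \<Rightarrow> 'c"
    and h :: "'a \<Rightarrow> 'b"
  assumes "clock T C" and "normalization_data C D"
    and "timed_space T C X p" and "timed_space T C Y q"
    and "timed_morphism X p Y q h"
  shows "(\<forall>x \<in> dpaths X. \<forall>s \<in> unit_I.
            compose unit_I h (npath D X p x) = npath D Y q (compose unit_I h x) \<and>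
            compose unit_I h (Hpath D X p x s) = Hpath D Y q (compose unit_I h x) s) \<and>
         (\<forall>u \<in> topspace (under X). \<forall>v \<in> topspace (under X).
            \<forall>(Z :: 'z topology) a B.
              in_Top T Z \<and>
              continuous_map Z (path_space X u v) a \<and>
              continuous_map (times_I Z) (trace_space X u v) B \<and>
              (\<forall>z \<in> topspace Z. B (z, 0) = trace_of X u v (a z)) \<longrightarrow>
              (\<forall>z \<in> topspace Z. \<forall>s \<in> unit_I.
                 path_push h (canonical_lift D X p a B (z, s)) =
                 canonical_lift D Y q (path_push h \<circ> a) (trace_push Y (h u) (h v) h \<circ> B) (z, s)))"
proof -
  interpret normalized_timed_morphism T C D X p Y q h
    by unfold_locales (fact assms)+
  have dX: "directed_space T X"
    using assms(3) by (simp add: timed_space_def)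
  have "path_push h (canonical_lift D X p a B (z, s)) =
      canonical_lift D Y q (path_push h \<circ> a) (trace_push Y (h u) (h v) h \<circ> B) (z, s)"
    if a: "continuous_map Z (path_space X u v) a"
      and B: "continuous_map (times_I Z) (trace_space X u v) B"
      and z: "z \<in> topspace Z" and s: "s \<in> unit_I"
    for u v and Z :: "'z topology" and a B z s
  proof -
    have "a z \<in> dpaths X"
      using continuous_map_funspace[OF a] z
      by (auto simp: topspace_path_space[OF dX] dpaths_between_def)
    moreover have "(z, s) \<in> topspace (times_I Z)"
      using z s by (simp add: times_I_def)
    then have "B (z, s) \<in> topspace (trace_space X u v)"
      using continuous_map_funspace[OF B] by auto
    \<comment> \<open>Points of the trace space are classes of directed paths, which provides the
      representative for \<open>Kpath_push\<close>.\<close>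
    then have "B (z, s) \<in> trace_of X u v ` dpaths_between X u v"
      using openin_trace_space[of X u v "topspace (trace_space X u v)"] by auto
    ultimately show ?thesis
      using Kpath_push s by (auto simp: canonical_lift_def)
  qed
  then show ?thesis
    using npath_push Hpath_push by metis
qed

end
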